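(* Let $G$ be a bi-orderable group. (i) If $G$ is nonabelian, then the natural action of $\mathrm{Aut}(G)$ on $\mathrm{LO}(G)$ is faithful. (ii) If $G$ is abelian, then the kernel of the natural action of $\mathrm{Aut}(G)$ on $\mathrm{LO}(G)$ consists precisely of those automorphisms of $G$ that are of the form $\tau_{p/q}$ for some positive rational $p/q$ for which $\tau_{p/q}$ exists.
   Context: A left-ordering of a group $G$ is a strict total ordering $<$ of $G$ such that $g<h$ implies $fg<fh$ for all $f,g,h\in G$; it is a bi-ordering if moreover $g<h$ implies $gf<hf$ for all $f,g,h \in G$. $G$ is left-orderable (bi-orderable) if it admits a left-ordering (bi-ordering). A left-ordering is identified with its positive cone $P=\{g\in G\mid g>1\}$; the positive cones of left-orderings are exactly the subsets $P\subset G$ with $P\cdot P\subset P$ and $G=P\sqcup P^{-1}\sqcup\{1\}$. $\mathrm{LO}(G)$ denotes the set of all positive cones of left-orderings of $G$. $\mathrm{Aut}(G)$ acts on $\mathrm{LO}(G)$ by $P\mapsto \phi(P)$ for $\phi\in\mathrm{Aut}(G)$. For an abelian group $G$ and positive integers $p,q$, $\tau_{p/q}:G\to G$ denotes the automorphism satisfying $\tau_{p/q}(g^q)=g^p$ for all $g\in G$, when such an automorphism exists. *)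

theory Defs
  imports "HOL-Algebra.Group_Action"
begin

definition left_ordering :: "('a, 'b) monoid_scheme \<Rightarrow> ('a \<times> 'a) set \<Rightarrow> bool" where
  "left_ordering G r \<longleftrightarrow>
     r \<subseteq> carrier G \<times> carrier G \<and> strict_linear_order_on (carrier G) r \<and>
     (\<forall>f\<in>carrier G. \<forall>g\<in>carrier G. \<forall>h\<in>carrier G.
        (g, h) \<in> r \<longrightarrow> (f \<otimes>\<^bsub>G\<^esub> g, f \<otimes>\<^bsub>G\<^esub> h) \<in> r)"

definition bi_ordering :: "('a, 'b) monoid_scheme \<Rightarrow> ('a \<times> 'a) set \<Rightarrow> bool" where
  "bi_ordering G r \<longleftrightarrow>
     left_ordering G r \<and>
     (\<forall>f\<in>carrier G. \<forall>g\<in>carrier G. \<forall>h\<in>carrier G.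
        (g, h) \<in> r \<longrightarrow> (g \<otimes>\<^bsub>G\<^esub> f, h \<otimes>\<^bsub>G\<^esub> f) \<in> r)"

definition bi_orderable :: "('a, 'b) monoid_scheme \<Rightarrow> bool" where
  "bi_orderable G \<longleftrightarrow> (\<exists>r. bi_ordering G r)"

definition positive_cone :: "('a, 'b) monoid_scheme \<Rightarrow> ('a \<times> 'a) set \<Rightarrow> 'a set" where
  "positive_cone G r = {g \<in> carrier G. (\<one>\<^bsub>G\<^esub>, g) \<in> r}"

definition LO :: "('a, 'b) monoid_scheme \<Rightarrow> 'a set set" where
  "LO G = {positive_cone G r | r. left_ordering G r}"

text \<open>The restriction to \<^term>\<open>LO G\<close> makes the value an element of
  \<^term>\<open>Bij (LO G)\<close>, which contains extensional functions only.\<close>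

definition LO_action :: "('a, 'b) monoid_scheme \<Rightarrow> ('a \<Rightarrow> 'a) \<Rightarrow> 'a set \<Rightarrow> 'a set" where
  "LO_action G \<phi> = (\<lambda>P\<in>LO G. \<phi> ` P)"

text \<open>The automorphism \<open>\<tau>\<^bsub>p/q\<^esub>\<close> need not exist, so it is rendered as a predicate;
  \<open>is_tau_unique\<close> below shows that on an abelian left-orderable group at most one
  automorphism satisfies it, and that it depends only on the rational \<open>p/q\<close>.\<close>

definition is_tau :: "('a, 'b) monoid_scheme \<Rightarrow> nat \<Rightarrow> nat \<Rightarrow> ('a \<Rightarrow> 'a) \<Rightarrow> bool" where
  "is_tau G p q \<phi> \<longleftrightarrow>
     \<phi> \<in> auto G \<and> (\<forall>g\<in>carrier G. \<phi> (g [^]\<^bsub>G\<^esub> q) = g [^]\<^bsub>G\<^esub> p)"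

lemma (in group) mem_LO_iff:
  "P \<in> LO G \<longleftrightarrow>
     P \<subseteq> carrier G \<and> (\<forall>x\<in>P. \<forall>y\<in>P. x \<otimes> y \<in> P) \<and> \<one> \<notin> P \<and>
     (\<forall>x\<in>P. inv x \<notin> P) \<and> (\<forall>x\<in>carrier G. x \<in> P \<or> inv x \<in> P \<or> x = \<one>)"
  (is "_ \<longleftrightarrow> ?R")
proof
  assume "P \<in> LO G"
  then obtain r where r: "r \<subseteq> carrier G \<times> carrier G" "trans r" "irrefl r"
      "total_on (carrier G) r"
    and inv: "\<And>f g h. f \<in> carrier G \<Longrightarrow> (g, h) \<in> r \<Longrightarrow> (f \<otimes> g, f \<otimes> h) \<in> r"
    and P: "P = {g \<in> carrier G. (\<one>, g) \<in> r}"
    unfolding LO_def left_ordering_def strict_linear_order_on_def positive_cone_def by blast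
  have neg: "(\<one>, inv x) \<in> r" if "x \<in> carrier G" "(x, \<one>) \<in> r" for x
    using inv[of "inv x" x \<one>] that by simp
  show ?R
  proof (intro conjI ballI)
    show "P \<subseteq> carrier G" "\<one> \<notin> P" using P r by (auto simp: irrefl_def)
  next
    fix x y assume "x \<in> P" "y \<in> P"
    then show "x \<otimes> y \<in> P"
      using inv[of x \<one> y] r(2) unfolding P by (auto dest: transD)
  next
    fix x assume "x \<in> P"
    then have x: "x \<in> carrier G" "(\<one>, x) \<in> r" by (auto simp: P)
    then have "(inv x, \<one>) \<in> r" using inv[of "inv x" \<one> x] by simp
    then show "inv x \<notin> P" using r(2,3) by (auto simp: P irrefl_def dest: transD)
  next
    fix x assume "x \<in> carrier G"
    then show "x \<in> P \<or> inv x \<in> P \<or> x = \<one>"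
      using r(4) neg by (auto simp: P total_on_def)
  qed
next
  assume R: ?R
  define r where "r = {(g, h). g \<in> carrier G \<and> h \<in> carrier G \<and> inv g \<otimes> h \<in> P}"
  have "left_ordering G r"
    unfolding left_ordering_def strict_linear_order_on_def
  proof (intro conjI ballI impI)
    show "r \<subseteq> carrier G \<times> carrier G" by (auto simp: r_def)
    show "irrefl r" using R by (auto simp: r_def irrefl_def)
    show "trans r"
    proof (rule transI)
      fix x y z assume a: "(x, y) \<in> r" "(y, z) \<in> r"
      then have c: "x \<in> carrier G" "y \<in> carrier G" "z \<in> carrier G" by (auto simp: r_def)
      have "(inv x \<otimes> y) \<otimes> (inv y \<otimes> z) \<in> P" using a R by (auto simp: r_def)
      also have "(inv x \<otimes> y) \<otimes> (inv y \<otimes> z) = inv x \<otimes> z"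
        using c by (metis inv_closed inv_solve_left m_assoc m_closed)
      finally show "(x, z) \<in> r" using c by (simp add: r_def)
    qed
    show "total_on (carrier G) r"
    proof (rule total_onI)
      fix x y assume c: "x \<in> carrier G" "y \<in> carrier G" "x \<noteq> y"
      then have "inv x \<otimes> y \<noteq> \<one>" by (metis inv_closed inv_equality inv_inv)
      moreover have "inv (inv x \<otimes> y) = inv y \<otimes> x" using c by (simp add: inv_mult_group)
      ultimately show "(x, y) \<in> r \<or> (y, x) \<in> r"
        using R c by (metis (mono_tags, lifting) case_prodI inv_closed m_closed mem_Collect_eq r_def)
    qed
  next
    fix f g h assume c: "f \<in> carrier G" "g \<in> carrier G" "h \<in> carrier G" "(g, h) \<in> r"
    have "inv (f \<otimes> g) \<otimes> (f \<otimes> h) = inv g \<otimes> h"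
      using c(1-3) by (metis inv_closed inv_mult_group inv_solve_left m_assoc m_closed)
    then show "(f \<otimes> g, f \<otimes> h) \<in> r" using c by (simp add: r_def)
  qed
  moreover have "P = positive_cone G r" using R by (auto simp: positive_cone_def r_def)
  ultimately show "P \<in> LO G" by (auto simp: LO_def)
qed

lemma (in group) image_mem_LO:
  assumes \<phi>: "\<phi> \<in> auto G" and P: "P \<in> LO G"
  shows "\<phi> ` P \<in> LO G"
proof -
  have hom: "\<phi> \<in> hom G G" and bij: "bij_betw \<phi> (carrier G) (carrier G)"
    using \<phi> by (auto simp: auto_def Bij_def)
  interpret h: group_hom G G \<phi> using hom by unfold_locales
  have inj: "inj_on \<phi> (carrier G)" and surj: "\<phi> ` carrier G = carrier G"
    using bij by (auto simp: bij_betw_def)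
  note P' = P[unfolded mem_LO_iff]
  have sub: "P \<subseteq> carrier G" using P' by blast
  have mem: "\<phi> x \<in> \<phi> ` P \<longleftrightarrow> x \<in> P" if "x \<in> carrier G" for x
    using inj sub that by (meson inj_on_image_mem_iff)
  show ?thesis unfolding mem_LO_iff
  proof (intro conjI)
    show "\<phi> ` P \<subseteq> carrier G" using sub by auto
    show "\<forall>x\<in>\<phi> ` P. \<forall>y\<in>\<phi> ` P. x \<otimes> y \<in> \<phi> ` P"
    proof clarify
      fix x y assume "x \<in> P" "y \<in> P"
      then have "x \<otimes> y \<in> P" "\<phi> x \<otimes> \<phi> y = \<phi> (x \<otimes> y)"
        using P' sub by (auto intro!: h.hom_mult[symmetric])
      then show "\<phi> x \<otimes> \<phi> y \<in> \<phi> ` P" by simp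
    qed
    show "\<one> \<notin> \<phi> ` P" using mem[of \<one>] P' by simp
    show "\<forall>x\<in>\<phi> ` P. inv x \<notin> \<phi> ` P"
    proof (rule ballI)
      fix y assume "y \<in> \<phi> ` P"
      then obtain x where x: "x \<in> P" "y = \<phi> x" by blast
      then have c: "x \<in> carrier G" using sub by auto
      have "inv x \<notin> P" using P' x by blast
      then show "inv y \<notin> \<phi> ` P" using mem[of "inv x"] c x by simp
    qed
    show "\<forall>x\<in>carrier G. x \<in> \<phi> ` P \<or> inv x \<in> \<phi> ` P \<or> x = \<one>"
    proof
      fix y assume "y \<in> carrier G"
      then obtain x where x: "x \<in> carrier G" "y = \<phi> x" using surj by blast
      then have "x \<in> P \<or> inv x \<in> P \<or> x = \<one>" using P' by blast
      then show "y \<in> \<phi> ` P \<or> inv y \<in> \<phi> ` P \<or> y = \<one>"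
        using x mem[of x] mem[of "inv x"] by auto
    qed
  qed
qed

lemma (in group) group_action_LO_action:
  "group_action (AutoGroup G) (LO G) (LO_action G)"
proof -
  have sub: "P \<subseteq> carrier G" if "P \<in> LO G" for P
    using that by (auto simp: LO_def positive_cone_def)
  have Bij: "LO_action G \<phi> \<in> Bij (LO G)" if "\<phi> \<in> auto G" for \<phi>
  proof -
    define \<psi> where "\<psi> = inv\<^bsub>BijGroup (carrier G)\<^esub> \<phi>"
    have \<phi>: "\<phi> \<in> Bij (carrier G)" using that by (simp add: auto_def)
    have \<psi>: "\<psi> \<in> auto G"
      unfolding \<psi>_def using subgroup_auto that by (rule subgroup.m_inv_closed)
    have \<psi>_eq: "\<psi> = (\<lambda>x\<in>carrier G. inv_into (carrier G) \<phi> x)"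
      unfolding \<psi>_def using \<phi> by (rule inv_BijGroup)
    have bij: "bij_betw \<phi> (carrier G) (carrier G)" using \<phi> by (simp add: Bij_def)
    have 1: "\<psi> ` \<phi> ` P = P" if "P \<in> LO G" for P
    proof -
      have "\<psi> (\<phi> x) = x" if "x \<in> carrier G" for x
        using bij that by (simp add: \<psi>_eq bij_betw_inv_into_left bij_betwE)
      then show ?thesis using sub[OF that] by (force simp: image_image subset_eq)
    qed
    have 2: "\<phi> ` \<psi> ` P = P" if "P \<in> LO G" for P
    proof -
      have "\<phi> (\<psi> x) = x" if "x \<in> carrier G" for x
        using bij that by (simp add: \<psi>_eq bij_betw_inv_into_right)
      then show ?thesis using sub[OF that] by (force simp: image_image subset_eq)
    qed
    have "bij_betw (LO_action G \<phi>) (LO G) (LO G)"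
      by (rule bij_betw_byWitness[where f' = "LO_action G \<psi>"])
        (auto simp: LO_action_def 1 2 image_mem_LO that \<psi>)
    then show ?thesis by (simp add: Bij_def LO_action_def)
  qed
  have "LO_action G (compose (carrier G) \<phi> \<psi>)
      = compose (LO G) (LO_action G \<phi>) (LO_action G \<psi>)"
    if "\<phi> \<in> auto G" "\<psi> \<in> auto G" for \<phi> \<psi>
  proof
    fix P
    show "LO_action G (compose (carrier G) \<phi> \<psi>) P
        = compose (LO G) (LO_action G \<phi>) (LO_action G \<psi>) P"
    proof (cases "P \<in> LO G")
      case True
      then have "compose (carrier G) \<phi> \<psi> ` P = \<phi> ` \<psi> ` P"
        using sub by (auto simp: compose_def image_image intro!: image_cong)
      then show ?thesis
        using True image_mem_LO[OF that(2) True] by (simp add: LO_action_def compose_def)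
    qed (simp add: LO_action_def compose_def)
  qed
  then have "LO_action G \<in> hom (AutoGroup G) (BijGroup (LO G))"
    by (auto simp: hom_def AutoGroup_def BijGroup_def Bij) (auto simp: auto_def)
  then show ?thesis
    by (intro group_action.intro group_hom.intro group_hom_axioms.intro
        AutoGroup group_BijGroup)
qed

lemma is_tau_unique:
  fixes G (structure)
  assumes "comm_group G" and LO: "LO G \<noteq> {}"
    and tau: "is_tau G p q \<phi>" "is_tau G p' q' \<psi>"
    and pos: "q > 0" "q' > 0" and eq: "p * q' = p' * q"
  shows "\<phi> = \<psi>"
proof -
  interpret comm_group G by fact
  from LO obtain P where P: "P \<in> LO G" by blast
  note P' = P[unfolded mem_LO_iff]
  have pow: "x [^] Suc n \<in> P" if "x \<in> P" for x and n :: nat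
  proof (induction n)
    case 0 then show ?case using that P' by auto
  next
    case (Suc n) then show ?case using that P' by (simp only: nat_pow_Suc[of x "Suc n"])
  qed
  have torsion_free: "x = \<one>" if "x \<in> carrier G" "x [^] n = \<one>" "n > 0" for x and n :: nat
  proof (rule ccontr)
    assume "x \<noteq> \<one>"
    then have "x \<in> P \<or> inv x \<in> P" using P' that by blast
    moreover obtain m where "n = Suc m" using \<open>n > 0\<close> by (cases n) auto
    ultimately have "x [^] n \<in> P \<or> inv x [^] n \<in> P" using pow by blast
    moreover have "inv x [^] n = \<one>" using that by (simp add: nat_pow_inv)
    ultimately show False using that P' by simp
  qed
  have aux: "\<chi> g \<in> carrier G \<and> (\<chi> g) [^] k = g [^] j"
    if "is_tau G j k \<chi>" "g \<in> carrier G" for \<chi> g and j k :: nat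
  proof -
    have "\<chi> \<in> hom G G" using that by (simp add: is_tau_def auto_def)
    then interpret h: group_hom G G \<chi> by unfold_locales
    show ?thesis using that by (simp add: is_tau_def flip: h.hom_nat_pow)
  qed
  have "\<phi> g = \<psi> g" if g: "g \<in> carrier G" for g
  proof -
    note a = aux[OF tau(1) g] aux[OF tau(2) g]
    have "\<phi> g [^] (q * q') = g [^] (p * q')" using a g by (simp flip: nat_pow_pow)
    also have "\<dots> = \<psi> g [^] (q * q')"
      using a g unfolding eq by (simp add: mult.commute[of q q'] flip: nat_pow_pow)
    finally have "\<phi> g [^] (q * q') = \<psi> g [^] (q * q')" .
    then have "(\<phi> g \<otimes> inv (\<psi> g)) [^] (q * q') = \<one>"
      using a by (simp add: nat_pow_distrib nat_pow_inv)
    then have "\<phi> g \<otimes> inv (\<psi> g) = \<one>" using torsion_free a pos by simp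
    then show ?thesis using a by (metis inv_closed inv_equality inv_inv)
  qed
  moreover have "\<phi> \<in> extensional (carrier G)" "\<psi> \<in> extensional (carrier G)"
    using tau by (auto simp: is_tau_def auto_def Bij_def)
  ultimately show ?thesis by (rule extensionalityI[rotated 2])
qed

end

theory Submission
  imports Defs
begin

text \<open>
  An automorphism \<open>\<phi>\<close> acts trivially on the left-orderings exactly when \<open>\<phi> g\<close> and \<open>g\<close> have the
  same sign in each of them, for every \<open>g\<close>. The proof shows first that two elements \<open>g\<close>, \<open>h\<close> of a
  bi-ordered group have the same sign in all left-orderings only if \<open>g\<^sup>m = h\<^sup>n\<close> for some
  \<open>m, n > 0\<close> (\<open>same_cones_imp_pos_commensurable\<close>), and then determines the endomorphisms that move
  every element within its class for this relation.

  For the first part, left-orderings are constructed from centralizers. Conjugation preserves a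
  bi-ordering, so the centralizer of any subset is a stabilizer for an action on an ordered
  set and hence left relatively convex: its left-orderings extend to \<open>G\<close>, with signs outside the
  centralizer that do not depend on those inside
  (\<open>centralizer_relatively_convex\<close>). If \<open>g\<close> and \<open>h\<close> do not commute, then \<open>h\<close> lies outside the
  centralizer of \<open>g\<close>, and reversing the order on that centralizer changes the sign of \<open>g\<close> but not
  that of \<open>h\<close>. If they commute, then they lie in an abelian subgroup that is itself a centralizer.
  When no positive power of \<open>g\<close> is a positive power of \<open>h\<close>, the
  subsemigroup generated by \<open>g\<close> and the inverse of \<open>h\<close> avoids \<open>1\<close>, and it extends to a cone of
  the abelian subgroup (\<open>semigroup_extends_to_cone\<close>) and then to one of \<open>G\<close>.

  For the second part, let \<open>G\<close> be nonabelian. Elements whose conjugation moves every element within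
  its class are central (\<open>commensurating_central\<close>): for such \<open>z\<close>, a commutator of \<open>z\<close> with another
  such element would be commensurable with both. For \<open>\<phi>\<close> in the kernel, \<open>x\<^sup>-\<^sup>1 \<phi>(x)\<close> is of this
  kind, hence central; but if it is not \<open>1\<close> it is commensurable with \<open>x\<close>, so \<open>x\<close> is central. Thus
  \<open>\<phi>\<close> fixes all noncentral elements, and these generate \<open>G\<close>
  (\<open>pos_commensurable_hom_trivial\<close>). If \<open>G\<close> is abelian and \<open>\<phi>(a)\<^sup>q = a\<^sup>p\<close> for one \<open>a \<noteq> 1\<close>, then the
  homomorphism \<open>\<phi>(g)\<^sup>q g\<^sup>-\<^sup>p\<close> kills \<open>a\<close> and sends each element to one with a nonzero power among the
  powers of that element. This forces it to be trivial
  (\<open>pos_commensurable_hom_uniform\<close>), so \<open>\<phi>\<close> is \<open>\<tau>\<^bsub>p/q\<^esub>\<close>. Conversely \<open>\<tau>\<^bsub>p/q\<^esub>\<close> preserves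
  signs, as \<open>g\<close> and its positive powers have the same sign.
\<close>

section \<open>Positive cones of left-orderings\<close>

context group
begin

lemma inv_image_mem_LO:
  assumes "P \<in> LO G"
  shows "m_inv G ` P \<in> LO G"
proof -
  note P = assms[unfolded mem_LO_iff]
  have sub: "P \<subseteq> carrier G" using P by blast
  have mem: "x \<in> m_inv G ` P \<longleftrightarrow> inv x \<in> P" if "x \<in> carrier G" for x
  proof
    assume "inv x \<in> P"
    then show "x \<in> m_inv G ` P" using that by (intro image_eqI[of _ _ "inv x"]) auto
  qed (use sub in auto)
  have sub': "m_inv G ` P \<subseteq> carrier G" using sub by auto
  show ?thesis unfolding mem_LO_iff
  proof (intro conjI ballI)
    show "m_inv G ` P \<subseteq> carrier G" by (rule sub')
    show "\<one> \<notin> m_inv G ` P" using P by (simp add: mem)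
  next
    fix x y assume "x \<in> m_inv G ` P" "y \<in> m_inv G ` P"
    moreover from this have "x \<in> carrier G" "y \<in> carrier G" using sub' by auto
    ultimately show "x \<otimes> y \<in> m_inv G ` P" using P by (simp add: mem inv_mult_group)
  next
    fix x assume "x \<in> m_inv G ` P"
    moreover from this have "x \<in> carrier G" using sub' by auto
    ultimately show "inv x \<notin> m_inv G ` P" using P by (auto simp: mem)
  next
    fix x assume "x \<in> carrier G"
    then show "x \<in> m_inv G ` P \<or> inv x \<in> m_inv G ` P \<or> x = \<one>" using P by (auto simp: mem)
  qed
qed

lemma LO_imp_cone_containing:
  assumes "LO G \<noteq> {}" "g \<in> carrier G" "g \<noteq> \<one>"
  shows "\<exists>P\<in>LO G. g \<in> P"
proof -
  from assms obtain P where P: "P \<in> LO G" by blast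
  then have "g \<in> P \<or> inv g \<in> P" using assms by (auto simp: mem_LO_iff)
  then have "g \<in> P \<or> g \<in> m_inv G ` P" using assms by (metis image_eqI inv_inv)
  then show ?thesis using P inv_image_mem_LO by blast
qed

lemma mem_LO_subgroup_iff:
  assumes "subgroup H G"
  shows "Q \<in> LO (G\<lparr>carrier := H\<rparr>) \<longleftrightarrow>
     Q \<subseteq> H \<and> (\<forall>x\<in>Q. \<forall>y\<in>Q. x \<otimes> y \<in> Q) \<and> \<one> \<notin> Q \<and>
     (\<forall>x\<in>Q. inv x \<notin> Q) \<and> (\<forall>x\<in>H. x \<in> Q \<or> inv x \<in> Q \<or> x = \<one>)"
  using group.mem_LO_iff[OF subgroup_imp_group[OF assms], of Q] assms
  by (auto simp: subset_iff)

lemma LO_subgroup: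
  assumes "subgroup H G" "P \<in> LO G"
  shows "P \<inter> H \<in> LO (G\<lparr>carrier := H\<rparr>)"
  using assms(2) subgroup.subset[OF assms(1)] subgroup.m_closed[OF assms(1)]
    subgroup.m_inv_closed[OF assms(1)]
  by (auto simp: mem_LO_subgroup_iff[OF assms(1)] mem_LO_iff)

lemma LO_nat_pow_mem:
  assumes "P \<in> LO G" "x \<in> P" "n > 0"
  shows "x [^] (n::nat) \<in> P"
  using \<open>n > 0\<close>
proof (induction n rule: nat_induct_non_zero)
  case 1 then show ?case using assms by (auto simp: mem_LO_iff)
next
  case (Suc n) then show ?case using assms by (simp add: mem_LO_iff)
qed

lemma LO_nat_pow_mem_iff:
  assumes P: "P \<in> LO G" and x: "x \<in> carrier G" and n: "n > 0"
  shows "x [^] (n::nat) \<in> P \<longleftrightarrow> x \<in> P"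
proof
  assume a: "x [^] n \<in> P"
  show "x \<in> P"
  proof (rule ccontr)
    assume "x \<notin> P"
    moreover have "x \<noteq> \<one>" using a P by (auto simp: mem_LO_iff)
    ultimately have "inv x \<in> P" using P x by (auto simp: mem_LO_iff)
    then have "inv (x [^] n) \<in> P" using LO_nat_pow_mem[OF P _ n] x by (simp flip: nat_pow_inv)
    then show False using a P by (auto simp: mem_LO_iff)
  qed
qed (rule LO_nat_pow_mem[OF P _ n])

lemma LO_subset_imp_eq:
  assumes P: "P \<in> LO G" "Q \<in> LO G" "P \<subseteq> Q"
  shows "P = Q"
  using assms unfolding mem_LO_iff by (metis subset_antisym subset_iff)

text \<open>Positive powers of an element other than \<open>1\<close> share its sign in any left-ordering.\<close>

lemma LO_torsion_free:
  assumes "LO G \<noteq> {}" "x \<in> carrier G" "x [^] (n::nat) = \<one>" "n > 0"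
  shows "x = \<one>"
proof (rule ccontr)
  assume "x \<noteq> \<one>"
  then obtain P where "P \<in> LO G" "x \<in> P" using LO_imp_cone_containing assms by blast
  then show False using LO_nat_pow_mem[of P x n] assms by (simp add: mem_LO_iff)
qed

end

text \<open>A subsemigroup that is maximal among those avoiding \<open>1\<close> is a positive cone: if neither
  \<open>x\<close> nor its inverse could be adjoined, then some \<open>x\<^sup>n\<close> and some \<open>x\<^sup>-\<^sup>m\<close> with \<open>m, n > 0\<close>
  would both lie in it, and so would \<open>1\<close>, their product after raising to suitable powers.\<close>

lemma (in comm_group) semigroup_extends_to_cone:
  assumes torsion_free: "\<And>x n. x \<in> carrier G \<Longrightarrow> x [^] (n::nat) = \<one> \<Longrightarrow> n > 0 \<Longrightarrow> x = \<one>"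
    and T: "T \<subseteq> carrier G" "\<And>x y. x \<in> T \<Longrightarrow> y \<in> T \<Longrightarrow> x \<otimes> y \<in> T" "\<one> \<notin> T"
  shows "\<exists>Q\<in>LO G. T \<subseteq> Q"
proof -
  define \<A> where "\<A> = {Q. T \<subseteq> Q \<and> Q \<subseteq> carrier G \<and> (\<forall>x\<in>Q. \<forall>y\<in>Q. x \<otimes> y \<in> Q) \<and> \<one> \<notin> Q}"
  have "\<exists>M\<in>\<A>. \<forall>X\<in>\<A>. M \<subseteq> X \<longrightarrow> X = M"
  proof (rule subset_Zorn_nonempty)
    show "\<A> \<noteq> {}" using T by (auto simp: \<A>_def)
    fix \<C> assume ne: "\<C> \<noteq> {}" and ch: "subset.chain \<A> \<C>"
    have sub: "\<C> \<subseteq> \<A>" using ch by (auto simp: subset.chain_def)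
    have "x \<otimes> y \<in> \<Union>\<C>" if xy: "x \<in> \<Union>\<C>" "y \<in> \<Union>\<C>" for x y
    proof -
      from xy obtain X Y where XY: "x \<in> X" "X \<in> \<C>" "y \<in> Y" "Y \<in> \<C>" by blast
      then have "X \<subseteq> Y \<or> Y \<subseteq> X" using ch by (auto simp: subset_chain_def)
      then obtain Z where "Z \<in> \<C>" "x \<in> Z" "y \<in> Z" using XY by blast
      moreover from this sub have "x \<otimes> y \<in> Z" by (auto simp: \<A>_def)
      ultimately show ?thesis by blast
    qed
    then show "\<Union>\<C> \<in> \<A>" using ne sub unfolding \<A>_def by blast
  qed
  then obtain M where M: "M \<in> \<A>" and max: "\<And>X. X \<in> \<A> \<Longrightarrow> M \<subseteq> X \<Longrightarrow> X = M" by blast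
  have sub: "M \<subseteq> carrier G" and mult: "\<And>x y. x \<in> M \<Longrightarrow> y \<in> M \<Longrightarrow> x \<otimes> y \<in> M"
    and one: "\<one> \<notin> M" and TM: "T \<subseteq> M" using M by (auto simp: \<A>_def)
  have pow: "x [^] n \<in> M" if "x \<in> M" "n > 0" for x and n :: nat
    using \<open>n > 0\<close>
  proof (induction n rule: nat_induct_non_zero)
    case 1 then show ?case using that sub by auto
  next
    case (Suc n) then show ?case using that mult by simp
  qed
  have inv_pow: "\<exists>n>0. inv x [^] (n::nat) \<in> M" if x: "x \<in> carrier G" "x \<notin> M" "x \<noteq> \<one>" for x
  proof (rule ccontr)
    assume none: "\<not> ?thesis"
    \<comment> \<open>the subsemigroup generated by \<open>M\<close> and \<open>x\<close>\<close>
    define X where "X = M \<union> {x [^] n \<otimes> t | n t. (n::nat) > 0 \<and> t \<in> insert \<one> M}"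
    have "X \<in> \<A>" unfolding \<A>_def
    proof (intro CollectI conjI ballI)
      show "T \<subseteq> X" using TM by (auto simp: X_def)
      show "X \<subseteq> carrier G" using sub x by (auto simp: X_def)
      have ne_one: "x [^] n \<otimes> t \<noteq> \<one>" if n: "n > 0" and t: "t \<in> insert \<one> M" for n :: nat and t
      proof
        assume eq: "x [^] n \<otimes> t = \<one>"
        show False
        proof (cases "t = \<one>")
          case True then show False using eq torsion_free x n by simp
        next
          case False
          then have tM: "t \<in> M" using t by simp
          have "t = inv (x [^] n)"
            using eq tM sub x by (metis inv_equality m_comm nat_pow_closed subsetD)
          then show False using none n tM x by (metis nat_pow_inv)
        qed
      qed
      show "\<one> \<notin> X"
      proof
        assume "\<one> \<in> X"
        then obtain n t where "(n::nat) > 0" "t \<in> insert \<one> M" "\<one> = x [^] n \<otimes> t"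
          unfolding X_def using one by blast
        with ne_one[OF this(1,2)] show False by simp
      qed
      fix y z assume yz: "y \<in> X" "z \<in> X"
      have form: "\<exists>(n::nat) t. t \<in> insert \<one> M \<and> w = x [^] n \<otimes> t \<and> (n > 0 \<or> t \<in> M)"
        if "w \<in> X" for w
      proof (cases "w \<in> M")
        case True
        then have "w = x [^] (0::nat) \<otimes> w" using sub by auto
        then show ?thesis using True by blast
      next
        case False
        then show ?thesis using that by (auto simp: X_def)
      qed
      from form[OF yz(1)] form[OF yz(2)] obtain n t n' t' where *:
        "t \<in> insert \<one> M" "y = x [^] (n::nat) \<otimes> t" "n > 0 \<or> t \<in> M"
        "t' \<in> insert \<one> M" "z = x [^] (n'::nat) \<otimes> t'" "n' > 0 \<or> t' \<in> M" by blast
      have tc: "t \<in> carrier G" "t' \<in> carrier G" using * sub by auto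
      have "y \<otimes> z = x [^] (n + n') \<otimes> (t \<otimes> t')"
        using * tc x by (simp add: m_ac flip: nat_pow_mult)
      moreover have "t \<otimes> t' \<in> insert \<one> M" using * mult tc by auto
      moreover have "n + n' > 0 \<or> t \<otimes> t' \<in> M" using * mult by auto
      ultimately show "y \<otimes> z \<in> X"
        unfolding X_def using tc by (cases "n + n' > 0") auto
    qed
    moreover have "M \<subseteq> X" by (auto simp: X_def)
    ultimately have "X = M" by (rule max)
    moreover have "x [^] (1::nat) \<otimes> \<one> \<in> X" unfolding X_def by blast
    ultimately show False using x by simp
  qed
  have "M \<in> LO G" unfolding mem_LO_iff
  proof (intro conjI ballI)
    show "M \<subseteq> carrier G" "\<one> \<notin> M" by fact+
    show "x \<otimes> y \<in> M" if "x \<in> M" "y \<in> M" for x y using that by (rule mult)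
    show "inv x \<notin> M" if "x \<in> M" for x
      using that one mult[of x "inv x"] sub by auto
    show "x \<in> M \<or> inv x \<in> M \<or> x = \<one>" if x: "x \<in> carrier G" for x
    proof (rule ccontr)
      assume n: "\<not> ?thesis"
      then obtain i where i: "i > 0" "inv x [^] (i::nat) \<in> M" using inv_pow x by blast
      have "inv x \<noteq> \<one>" using n x by (metis inv_inv inv_one)
      then obtain j where j: "j > 0" "x [^] (j::nat) \<in> M" using inv_pow[of "inv x"] n x by auto
      have "x [^] (j * i) \<in> M" using pow[OF j(2) i(1)] x by (simp add: nat_pow_pow)
      moreover have "inv (x [^] (j * i)) \<in> M"
        using pow[OF i(2) j(1)] x by (simp add: nat_pow_pow nat_pow_inv mult.commute)
      ultimately have "\<one> \<in> M" using mult[of "x [^] (j * i)" "inv (x [^] (j * i))"] x by simp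
      then show False using one by blast
    qed
  qed
  then show ?thesis using TM by blast
qed

lemma (in group) semigroup_extends_to_subgroup_cone:
  assumes LO: "LO G \<noteq> {}" and H: "subgroup H G"
    and comm: "\<And>x y. x \<in> H \<Longrightarrow> y \<in> H \<Longrightarrow> x \<otimes> y = y \<otimes> x"
    and T: "T \<subseteq> H" "\<And>x y. x \<in> T \<Longrightarrow> y \<in> T \<Longrightarrow> x \<otimes> y \<in> T" "\<one> \<notin> T"
  shows "\<exists>Q\<in>LO (G\<lparr>carrier := H\<rparr>). T \<subseteq> Q"
proof (rule comm_group.semigroup_extends_to_cone)
  show "comm_group (G\<lparr>carrier := H\<rparr>)"
    by (rule group.group_comm_groupI[OF subgroup_imp_group[OF H]]) (simp, rule comm)
  show "x = \<one>\<^bsub>G\<lparr>carrier := H\<rparr>\<^esub>"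
    if "x \<in> carrier (G\<lparr>carrier := H\<rparr>)" "x [^]\<^bsub>G\<lparr>carrier := H\<rparr>\<^esub> n = \<one>\<^bsub>G\<lparr>carrier := H\<rparr>\<^esub>" "n > 0"
    for x and n :: nat
    using that LO_torsion_free[OF LO, of x n] subgroup.mem_carrier[OF H]
    by (simp flip: nat_pow_consistent)
qed (use T in auto)

section \<open>Centralizers in a bi-ordered group\<close>

definition (in group) centralizer :: "'a set \<Rightarrow> 'a set" where
  "centralizer S = {x \<in> carrier G. \<forall>s\<in>S. x \<otimes> s = s \<otimes> x}"

definition (in group) conjugate :: "'a \<Rightarrow> 'a \<Rightarrow> 'a" where
  "conjugate x y = x \<otimes> y \<otimes> inv x"

context group
begin

lemma conjugate_closed [simp]: "x \<in> carrier G \<Longrightarrow> y \<in> carrier G \<Longrightarrow> conjugate x y \<in> carrier G"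
  by (simp add: conjugate_def)

lemma conjugate_eq_iff:
  "x \<in> carrier G \<Longrightarrow> y \<in> carrier G \<Longrightarrow> conjugate x y = y \<longleftrightarrow> x \<otimes> y = y \<otimes> x"
  unfolding conjugate_def by (metis inv_solve_right m_closed)

lemma conjugate_mult:
  "x \<in> carrier G \<Longrightarrow> y \<in> carrier G \<Longrightarrow> z \<in> carrier G \<Longrightarrow> conjugate (x \<otimes> y) z = conjugate x (conjugate y z)"
  by (simp add: conjugate_def inv_mult_group m_assoc)

lemma conjugate_one [simp]: "x \<in> carrier G \<Longrightarrow> conjugate \<one> x = x"
  by (simp add: conjugate_def)

lemma conjugate_conjugate_inv [simp]:
  "x \<in> carrier G \<Longrightarrow> y \<in> carrier G \<Longrightarrow> conjugate x (conjugate (inv x) y) = y"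
  by (simp flip: conjugate_mult)

lemma conjugate_inv_conjugate [simp]:
  "x \<in> carrier G \<Longrightarrow> y \<in> carrier G \<Longrightarrow> conjugate (inv x) (conjugate x y) = y"
  by (simp flip: conjugate_mult)

lemma conjugate_mult_right:
  assumes "x \<in> carrier G" "y \<in> carrier G" "z \<in> carrier G"
  shows "conjugate x (y \<otimes> z) = conjugate x y \<otimes> conjugate x z"
proof -
  have "inv x \<otimes> (x \<otimes> (z \<otimes> inv x)) = z \<otimes> inv x" using assms by (simp flip: m_assoc)
  then show ?thesis using assms by (simp add: conjugate_def m_assoc)
qed

lemma conjugate_nat_pow:
  "x \<in> carrier G \<Longrightarrow> y \<in> carrier G \<Longrightarrow> conjugate x (y [^] (n::nat)) = conjugate x y [^] n"
proof (induction n)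
  case 0 then show ?case by (simp add: conjugate_def)
qed (simp add: conjugate_mult_right)

lemma conjugate_inv: "x \<in> carrier G \<Longrightarrow> y \<in> carrier G \<Longrightarrow> conjugate x (inv y) = inv (conjugate x y)"
  by (simp add: conjugate_def inv_mult_group m_assoc)

lemma centralizer_conjugate:
  "S \<subseteq> carrier G \<Longrightarrow> x \<in> centralizer S \<longleftrightarrow> x \<in> carrier G \<and> (\<forall>s\<in>S. conjugate x s = s)"
  by (auto simp: centralizer_def conjugate_eq_iff subset_iff)

lemma subgroup_centralizer:
  assumes "S \<subseteq> carrier G"
  shows "subgroup (centralizer S) G"
proof (rule subgroupI)
  show "centralizer S \<subseteq> carrier G" by (auto simp: centralizer_def)
  have "\<one> \<in> centralizer S" using assms by (auto simp: centralizer_def)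
  then show "centralizer S \<noteq> {}" by blast
  show "inv x \<in> centralizer S" if x: "x \<in> centralizer S" for x
  proof -
    have c: "x \<in> carrier G" "\<And>s. s \<in> S \<Longrightarrow> conjugate x s = s"
      using x assms by (auto simp: centralizer_conjugate)
    have "conjugate (inv x) s = s" if "s \<in> S" for s
      using conjugate_inv_conjugate[of x s] c that assms by auto
    then show ?thesis using c assms by (auto simp: centralizer_conjugate)
  qed
  show "x \<otimes> y \<in> centralizer S" if "x \<in> centralizer S" "y \<in> centralizer S" for x y
    using that assms by (auto simp: centralizer_conjugate conjugate_mult subset_iff)
qed

end

locale bi_ordered_group = group G for G (structure) +
  fixes r :: "('a \<times> 'a) set"
  assumes bi_ordering: "bi_ordering G r"
begin

abbreviation less (infix "\<prec>" 50) where "x \<prec> y \<equiv> (x, y) \<in> r"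

lemma less_irrefl: "\<not> x \<prec> x"
  and less_trans: "x \<prec> y \<Longrightarrow> y \<prec> z \<Longrightarrow> x \<prec> z"
  and less_total: "x \<in> carrier G \<Longrightarrow> y \<in> carrier G \<Longrightarrow> x \<noteq> y \<Longrightarrow> x \<prec> y \<or> y \<prec> x"
  using bi_ordering
  by (auto simp: bi_ordering_def left_ordering_def strict_linear_order_on_def irrefl_def
      total_on_def dest: transD)

lemma mult_left_mono: "x \<prec> y \<Longrightarrow> z \<in> carrier G \<Longrightarrow> z \<otimes> x \<prec> z \<otimes> y"
  and mult_right_mono: "x \<prec> y \<Longrightarrow> z \<in> carrier G \<Longrightarrow> x \<otimes> z \<prec> y \<otimes> z"
  and less_closed: "x \<prec> y \<Longrightarrow> x \<in> carrier G \<and> y \<in> carrier G"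
  using bi_ordering unfolding bi_ordering_def left_ordering_def by blast+

lemma LO_nonempty: "LO G \<noteq> {}"
  using bi_ordering unfolding bi_ordering_def LO_def by blast

lemma conjugate_mono: "x \<prec> y \<Longrightarrow> z \<in> carrier G \<Longrightarrow> conjugate z x \<prec> conjugate z y"
  unfolding conjugate_def by (simp add: mult_left_mono mult_right_mono)

lemma nat_pow_mono:
  assumes "x \<prec> y" "n > 0"
  shows "x [^] (n::nat) \<prec> y [^] n"
  using \<open>n > 0\<close>
proof (induction n rule: nat_induct_non_zero)
  case 1 then show ?case using assms less_closed by simp
next
  case (Suc n)
  have c: "x \<in> carrier G" "y \<in> carrier G" using assms less_closed by blast+
  have "x [^] n \<otimes> x \<prec> y [^] n \<otimes> x" using Suc c by (simp add: mult_right_mono)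
  moreover have "y [^] n \<otimes> x \<prec> y [^] n \<otimes> y" using assms c by (simp add: mult_left_mono)
  ultimately show ?case using less_trans by auto
qed

lemma root_unique:
  assumes "x \<in> carrier G" "y \<in> carrier G" "x [^] (n::nat) = y [^] n" "n > 0"
  shows "x = y"
  using assms less_total less_irrefl nat_pow_mono by metis

text \<open>Conjugation preserves a bi-ordering, so that \<open>G\<close> acts on an ordered set, and
  \<open>centralizer S\<close> is the pointwise stabilizer of \<open>S\<close>. As for every stabilizer of this kind, its
  cosets carry an order: well-order \<open>S\<close>, and call an element outside the stabilizer positive when
  it moves up the first element of \<open>S\<close> that it moves. These positive elements \<open>T\<close> complete
  every cone of the stabilizer to a cone of \<open>G\<close>, so the sign on the stabilizer may be chosen
  independently of the sign outside.\<close>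

lemma centralizer_relatively_convex:
  assumes S: "S \<subseteq> carrier G"
  shows "\<exists>T. T \<inter> centralizer S = {} \<and>
    (\<forall>Q \<in> LO (G\<lparr>carrier := centralizer S\<rparr>). Q \<union> T \<in> LO G)"
proof -
  define A where "A = centralizer S"
  have A: "x \<in> A \<longleftrightarrow> x \<in> carrier G \<and> (\<forall>s\<in>S. conjugate x s = s)" for x
    unfolding A_def by (rule centralizer_conjugate[OF S])
  have subA: "subgroup A G" unfolding A_def by (rule subgroup_centralizer[OF S])
  obtain W where W: "well_order_on S W" using well_order_on by blast
  then have wf: "wf (W - Id)" and tot: "total_on S W"
    by (auto simp: well_order_on_def linear_order_on_def)
  define first where "first x s \<longleftrightarrow>
    s \<in> S \<and> conjugate x s \<noteq> s \<and> (\<forall>t\<in>S. (t, s) \<in> W - Id \<longrightarrow> conjugate x t = t)" for x s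
  have first_unique: "s = t" if "first x s" "first x t" for x s t
    using that tot unfolding first_def total_on_def by blast
  define T where "T = {x \<in> carrier G. \<exists>s. first x s \<and> s \<prec> conjugate x s}"
  have T_up: "s \<prec> conjugate x s" if "x \<in> T" "first x s" for x s
    using that first_unique by (auto simp: T_def)
  have disj: "T \<inter> A = {}" by (auto simp: T_def A first_def)
  have first_exists: "\<exists>s\<in>B. \<forall>t\<in>S. (t, s) \<in> W - Id \<longrightarrow> t \<notin> B" if "B \<noteq> {}" for B
    by (rule wfE_min'[OF wf that]) blast
  have T_mult: "x \<otimes> y \<in> T"
    if xy: "x \<in> A \<union> T" "y \<in> A \<union> T" "x \<in> T \<or> y \<in> T" for x y
  proof -
    have c: "x \<in> carrier G" "y \<in> carrier G" using xy by (auto simp: A T_def)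
    \<comment> \<open>the first element moved by \<open>x\<close> or by \<open>y\<close>: neither moves it down, and one moves it up\<close>
    have "{s \<in> S. conjugate x s \<noteq> s \<or> conjugate y s \<noteq> s} \<noteq> {}" using xy by (auto simp: T_def first_def)
    from first_exists[OF this] obtain s where
      s: "s \<in> S" "conjugate x s \<noteq> s \<or> conjugate y s \<noteq> s"
      and fixed: "\<And>t. t \<in> S \<Longrightarrow> (t, s) \<in> W - Id \<Longrightarrow> conjugate x t = t \<and> conjugate y t = t" by blast
    have sc: "s \<in> carrier G" using s S by blast
    have up: "conjugate z s = s \<or> s \<prec> conjugate z s" if z: "z = x \<or> z = y" for z
    proof (cases "conjugate z s = s")
      case False
      then have "first z s" using s fixed z by (auto simp: first_def)
      moreover have "z \<in> T" using z xy False s by (auto simp: A)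
      ultimately show ?thesis using T_up by blast
    qed simp
    have "s \<prec> conjugate x (conjugate y s)"
    proof (cases "conjugate y s = s")
      case True
      then show ?thesis using up[of x] s by auto
    next
      case False
      then have "conjugate x s \<prec> conjugate x (conjugate y s)" using up[of y] conjugate_mono c by blast
      then show ?thesis using up[of x] less_trans by metis
    qed
    then have "s \<prec> conjugate (x \<otimes> y) s" using c sc by (simp add: conjugate_mult)
    moreover from this have "first (x \<otimes> y) s"
      unfolding first_def using s fixed S c less_irrefl by (metis conjugate_mult subsetD)
    ultimately show ?thesis using c by (auto simp: T_def)
  qed
  have T_total: "x \<in> T \<or> inv x \<in> T" if x: "x \<in> carrier G" "x \<notin> A" for x
  proof -
    have "{s \<in> S. conjugate x s \<noteq> s} \<noteq> {}" using x by (auto simp: A)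
    from first_exists[OF this] obtain s where s: "first x s" by (auto simp: first_def)
    then have sc: "s \<in> S" "s \<in> carrier G" "conjugate x s \<noteq> s" using S by (auto simp: first_def)
    have fixed_iff: "conjugate (inv x) t = t \<longleftrightarrow> conjugate x t = t" if "t \<in> S" for t
      using that S x conjugate_conjugate_inv[of x t] conjugate_inv_conjugate[of x t] by (metis subsetD)
    have "first (inv x) s" using s fixed_iff by (simp add: first_def)
    moreover have "s \<prec> conjugate (inv x) s" if "conjugate x s \<prec> s"
      using conjugate_mono[OF that, of "inv x"] x sc by simp
    ultimately show ?thesis using s less_total[of s "conjugate x s"] x sc by (auto simp: T_def)
  qed
  have "Q \<union> T \<in> LO G" if "Q \<in> LO (G\<lparr>carrier := A\<rparr>)" for Q
  proof -
    note Q = that[unfolded mem_LO_subgroup_iff[OF subA]]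
    have QA: "Q \<subseteq> A" using Q by blast
    have one: "\<one> \<in> A" using subA by (rule subgroup.one_closed)
    show ?thesis unfolding mem_LO_iff
    proof (intro conjI ballI)
      show "Q \<union> T \<subseteq> carrier G" using QA by (auto simp: A T_def)
      show one': "\<one> \<notin> Q \<union> T" using Q disj one by blast
      show mult: "x \<otimes> y \<in> Q \<union> T" if "x \<in> Q \<union> T" "y \<in> Q \<union> T" for x y
        using that QA Q T_mult[of x y] by blast
      show "inv x \<notin> Q \<union> T" if x: "x \<in> Q \<union> T" for x
      proof
        assume "inv x \<in> Q \<union> T"
        then have "x \<otimes> inv x \<in> Q \<union> T" using mult x by blast
        moreover have "x \<in> carrier G" using x QA by (auto simp: A T_def)
        ultimately show False using one' by simp
      qed
      show "x \<in> Q \<union> T \<or> inv x \<in> Q \<union> T \<or> x = \<one>" if "x \<in> carrier G" for x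
        using that Q T_total[of x] by blast
    qed
  qed
  then show ?thesis using disj unfolding A_def by blast
qed

end

section \<open>Commensurable elements\<close>

context group
begin

text \<open>Left-orderings only see positive powers, so the kernel of the action is described by \<open>\<sim>\<close>.
  The relation \<open>\<approx>\<close> is unaffected by inverses, which makes it suitable for commutators.\<close>

definition commensurable :: "'a \<Rightarrow> 'a \<Rightarrow> bool" (infix "\<approx>" 50) where
  "x \<approx> y \<longleftrightarrow> (\<exists>(i::int) (j::int). i \<noteq> 0 \<and> j \<noteq> 0 \<and> x [^] i = y [^] j)"

definition pos_commensurable :: "'a \<Rightarrow> 'a \<Rightarrow> bool" (infix "\<sim>" 50) where
  "x \<sim> y \<longleftrightarrow> (\<exists>(m::nat) (n::nat). m > 0 \<and> n > 0 \<and> x [^] m = y [^] n)"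

lemma pos_commensurable_sym: "x \<sim> y \<Longrightarrow> y \<sim> x"
  unfolding pos_commensurable_def by metis

lemma commensurable_sym: "x \<approx> y \<Longrightarrow> y \<approx> x"
  unfolding commensurable_def by metis

lemma pos_commensurable_trans:
  assumes "x \<sim> y" "y \<sim> z" "x \<in> carrier G" "y \<in> carrier G" "z \<in> carrier G"
  shows "x \<sim> z"
proof -
  from assms obtain m n k l :: nat where
    *: "m > 0" "n > 0" "x [^] m = y [^] n" "k > 0" "l > 0" "y [^] k = z [^] l"
    by (auto simp: pos_commensurable_def)
  have "x [^] (m * k) = (y [^] n) [^] k" using * assms by (simp flip: nat_pow_pow)
  also have "\<dots> = (y [^] k) [^] n" using assms by (simp add: nat_pow_pow mult.commute)
  also have "\<dots> = z [^] (l * n)" using * assms by (simp add: nat_pow_pow)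
  finally show ?thesis
    unfolding pos_commensurable_def using * by (intro exI[of _ "m * k"] exI[of _ "l * n"]) simp
qed

lemma commensurable_trans:
  assumes "x \<approx> y" "y \<approx> z" "x \<in> carrier G" "y \<in> carrier G" "z \<in> carrier G"
  shows "x \<approx> z"
proof -
  from assms obtain m n k l :: int where
    *: "m \<noteq> 0" "n \<noteq> 0" "x [^] m = y [^] n" "k \<noteq> 0" "l \<noteq> 0" "y [^] k = z [^] l"
    by (auto simp: commensurable_def)
  have "x [^] (m * k) = (y [^] n) [^] k" using * assms by (simp flip: int_pow_pow)
  also have "\<dots> = (y [^] k) [^] n" using assms by (simp add: int_pow_pow mult.commute)
  also have "\<dots> = z [^] (l * n)" using * assms by (simp add: int_pow_pow)
  finally show ?thesis
    unfolding commensurable_def using * by (intro exI[of _ "m * k"] exI[of _ "l * n"]) simp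
qed

lemma commensurable_inv:
  assumes "x \<approx> y" "x \<in> carrier G" "y \<in> carrier G"
  shows "inv x \<approx> y"
proof -
  from assms obtain i j :: int where *: "i \<noteq> 0" "j \<noteq> 0" "x [^] i = y [^] j"
    by (auto simp: commensurable_def)
  then have "inv x [^] i = y [^] (- j)" using assms by (simp add: int_pow_inv int_pow_neg)
  then show ?thesis
    unfolding commensurable_def using * by (intro exI[of _ i] exI[of _ "- j"]) simp
qed

lemma pos_commensurable_imp: "x \<sim> y \<Longrightarrow> x \<approx> y"
proof -
  assume "x \<sim> y"
  then obtain m n :: nat where "m > 0" "n > 0" "x [^] m = y [^] n"
    by (auto simp: pos_commensurable_def)
  then show "x \<approx> y"
    unfolding commensurable_def by (intro exI[of _ "int m"] exI[of _ "int n"]) (simp add: int_pow_int)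
qed

lemma pos_commensurable_conjugate:
  assumes "x \<sim> y" "x \<in> carrier G" "y \<in> carrier G" "z \<in> carrier G"
  shows "conjugate z x \<sim> conjugate z y"
proof -
  from assms obtain m n :: nat where *: "m > 0" "n > 0" "x [^] m = y [^] n"
    by (auto simp: pos_commensurable_def)
  then have "conjugate z x [^] m = conjugate z y [^] n"
    using assms by (simp flip: conjugate_nat_pow)
  then show ?thesis using * by (auto simp: pos_commensurable_def)
qed

lemma pos_commensurable_refl: "x \<sim> x"
  unfolding pos_commensurable_def by blast

end

context bi_ordered_group
begin

lemma int_pow_eq_one:
  assumes "x \<in> carrier G" "x [^] (i::int) = \<one>" "i \<noteq> 0"
  shows "x = \<one>"
proof -
  have "x [^] nat \<bar>i\<bar> = \<one>"
    using assms by (auto simp: int_pow_def2 abs_if simp del: pow_nat split: if_splits)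
  then show ?thesis using LO_torsion_free[OF LO_nonempty, of x "nat \<bar>i\<bar>"] assms by (simp del: pow_nat)
qed

text \<open>If \<open>y\<close> commutes with \<open>x\<^sup>n\<close>, then \<open>x\<close> and its conjugate by \<open>y\<close> are both \<open>n\<close>-th
  roots of \<open>x\<^sup>n\<close>, and roots are unique in a bi-ordered group.\<close>

lemma commute_nat_root:
  assumes "x \<in> carrier G" "y \<in> carrier G" "n > 0" "y \<otimes> x [^] (n::nat) = x [^] n \<otimes> y"
  shows "y \<otimes> x = x \<otimes> y"
proof -
  have "conjugate y x [^] n = x [^] n" using assms conjugate_eq_iff[of y "x [^] n"] by (simp add: conjugate_nat_pow)
  then show ?thesis using root_unique[of "conjugate y x" x n] assms by (simp add: conjugate_eq_iff)
qed

lemma commute_int_root: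
  assumes "x \<in> carrier G" "y \<in> carrier G" "i \<noteq> 0" "y \<otimes> x [^] (i::int) = x [^] i \<otimes> y"
  shows "y \<otimes> x = x \<otimes> y"
proof (cases "i < 0")
  case False
  then show ?thesis using commute_nat_root[of x y "nat i"] assms by (simp add: int_pow_def2 del: pow_nat)
next
  case True
  define u where "u = x [^] nat (- i)"
  have u: "u \<in> carrier G" "x [^] i = inv u" using True assms by (auto simp: u_def int_pow_def2 simp del: pow_nat)
  have "conjugate y (inv u) = inv u" using assms u by (simp add: conjugate_eq_iff)
  then have "conjugate y u = u" using assms u
    by (metis conjugate_inv conjugate_closed inv_inv)
  then show ?thesis
    using commute_nat_root[of x y "nat (- i)"] True assms u by (simp add: conjugate_eq_iff u_def del: pow_nat)
qed

lemma commute_commensurable: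
  assumes "x \<approx> y" "x \<in> carrier G" "y \<in> carrier G" "z \<in> carrier G" "z \<otimes> y = y \<otimes> z"
  shows "z \<otimes> x = x \<otimes> z"
proof -
  from assms obtain i j :: int where *: "i \<noteq> 0" "j \<noteq> 0" "x [^] i = y [^] j"
    by (auto simp: commensurable_def)
  have nat: "z \<otimes> y [^] n = y [^] n \<otimes> z" for n :: nat
  proof -
    have "conjugate z (y [^] n) = y [^] n"
      using assms by (simp add: conjugate_nat_pow iffD2[OF conjugate_eq_iff])
    then show ?thesis using assms by (simp add: conjugate_eq_iff)
  qed
  have "conjugate z (y [^] j) = y [^] j"
    using nat assms by (simp add: int_pow_def2 conjugate_inv iffD2[OF conjugate_eq_iff] del: pow_nat)
  then have "z \<otimes> x [^] i = x [^] i \<otimes> z" using * assms by (simp add: conjugate_eq_iff)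
  then show ?thesis using commute_int_root * assms by blast
qed

lemma commensurable_imp_commute:
  "x \<approx> y \<Longrightarrow> x \<in> carrier G \<Longrightarrow> y \<in> carrier G \<Longrightarrow> x \<otimes> y = y \<otimes> x"
  using commute_commensurable[of x y y] by simp

text \<open>From \<open>x\<^sup>m = y\<^sup>n\<close> and commutation, \<open>(x y\<^sup>-\<^sup>1)\<^sup>m = y\<^sup>n\<^sup>-\<^sup>m\<close>, and \<open>m \<noteq> n\<close> by uniqueness of
  roots. The quotient may lie on the other side of \<open>1\<close>, so this needs integer exponents.\<close>

lemma pos_commensurable_quotient:
  assumes "x \<sim> y" "x \<in> carrier G" "y \<in> carrier G" "x \<noteq> y"
  shows "x \<otimes> inv y \<approx> y"
proof -
  from assms obtain m n :: nat where *: "m > 0" "n > 0" "x [^] m = y [^] n"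
    by (auto simp: pos_commensurable_def)
  have "x \<otimes> y = y \<otimes> x" using commensurable_imp_commute pos_commensurable_imp assms by blast
  then have comm: "x \<otimes> inv y = inv y \<otimes> x"
    using assms by (metis inv_closed inv_solve_left' inv_solve_right m_assoc m_closed)
  have "(x \<otimes> inv y) [^] int m = x [^] int m \<otimes> inv y [^] int m"
    using int_pow_mult_distrib[OF comm] assms by simp
  also have "\<dots> = y [^] int n \<otimes> inv (y [^] int m)"
    using * assms by (simp add: int_pow_int int_pow_inv nat_pow_inv)
  also have "\<dots> = y [^] (int n - int m)" using assms by (simp add: int_pow_diff)
  finally have eq: "(x \<otimes> inv y) [^] int m = y [^] (int n - int m)" .
  have "int n - int m \<noteq> 0"
  proof
    assume "int n - int m = 0"
    then have "x [^] m = y [^] m" using * by simp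
    then show False using root_unique assms * by blast
  qed
  then show ?thesis
    unfolding commensurable_def using eq *
    by (intro exI[of _ "int m"] exI[of _ "int n - int m"]) simp
qed

section \<open>Elements that all left-orderings give the same sign\<close>

text \<open>If \<open>g\<close> and \<open>h\<close> do not commute, reverse the order on the centralizer of \<open>g\<close>, which does
  not contain \<open>h\<close>. If they commute, the centralizer \<open>A\<close> of \<open>S\<close> below is an abelian subgroup
  containing both, and a cone of \<open>A\<close> that separates them extends to \<open>G\<close>.\<close>

lemma same_cones_imp_pos_commensurable:
  assumes g: "g \<in> carrier G" and h: "h \<in> carrier G"
    and same: "\<And>P. P \<in> LO G \<Longrightarrow> g \<in> P \<longleftrightarrow> h \<in> P"
  shows "g \<sim> h"
proof (cases "g = \<one> \<or> h = \<one>")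
  case True
  have "g = \<one>" "h = \<one>"
    using True LO_imp_cone_containing[OF LO_nonempty] same g h by (metis mem_LO_iff)+
  then show ?thesis by (simp add: pos_commensurable_refl)
next
  case False
  then have ne: "g \<noteq> \<one>" "h \<noteq> \<one>" by auto
  have commute: "g \<otimes> h = h \<otimes> g"
  proof (rule ccontr)
    assume nc: "g \<otimes> h \<noteq> h \<otimes> g"
    define A where "A = centralizer {g}"
    have A: "subgroup A G" "g \<in> A" "h \<notin> A"
      using g h nc subgroup_centralizer[of "{g}"] by (auto simp: A_def centralizer_def)
    obtain T where T: "T \<inter> A = {}" "\<And>Q. Q \<in> LO (G\<lparr>carrier := A\<rparr>) \<Longrightarrow> Q \<union> T \<in> LO G"
      using centralizer_relatively_convex[of "{g}"] g unfolding A_def by auto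
    obtain P where P: "P \<in> LO G" "g \<in> P" using LO_imp_cone_containing[OF LO_nonempty g ne(1)] by blast
    have "P \<inter> A \<union> T \<in> LO G" using T LO_subgroup A P by blast
    from same[OF this] have "h \<in> T" using A P by blast
    \<comment> \<open>the sign of \<open>h\<close> outside \<open>A\<close> stays the same, that of \<open>g\<close> inside \<open>A\<close> is reversed\<close>
    have gP: "g \<notin> m_inv G ` P" using P by (auto simp: mem_LO_iff)
    have "m_inv G ` P \<inter> A \<union> T \<in> LO G" using T LO_subgroup A P inv_image_mem_LO by blast
    from same[OF this] show False using gP \<open>h \<in> T\<close> T A by blast
  qed
  show ?thesis
  proof (rule ccontr)
    assume not_comm: "\<not> g \<sim> h"
    \<comment> \<open>\<open>S\<close> contains its own centralizer, which makes that centralizer abelian\<close>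
    define S where "S = {g, h} \<union> centralizer {g, h}"
    define A where "A = centralizer S"
    have S: "S \<subseteq> carrier G" using g h by (auto simp: S_def centralizer_def)
    have A: "subgroup A G" unfolding A_def by (rule subgroup_centralizer[OF S])
    have AC: "A \<subseteq> carrier G" by (rule subgroup.subset[OF A])
    have ghA: "g \<in> A" "h \<in> A"
      using g h commute by (auto simp: A_def S_def centralizer_def)
    have A_comm: "x \<otimes> y = y \<otimes> x" if "x \<in> A" "y \<in> A" for x y
    proof -
      have "y \<in> S" using that(2) unfolding A_def S_def centralizer_def by blast
      then show ?thesis using that(1) unfolding A_def centralizer_def by blast
    qed
    define U where "U = {g [^] m \<otimes> inv h [^] n | (m::nat) (n::nat). m > 0 \<or> n > 0}"
    have one: "\<one> \<notin> U"
    proof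
      assume "\<one> \<in> U"
      then obtain m n :: nat where mn: "m > 0 \<or> n > 0" "\<one> = g [^] m \<otimes> inv h [^] n"
        unfolding U_def by blast
      have eq: "g [^] m = h [^] n"
        using mn(2)[symmetric] g h inv_equality[of "g [^] m" "inv (h [^] n)"] by (simp add: nat_pow_inv)
      show False
      proof (cases "m = 0 \<or> n = 0")
        case True
        then have "h [^] n = \<one> \<and> n > 0 \<or> g [^] m = \<one> \<and> m > 0" using eq mn(1) by auto
        then show False
          using LO_torsion_free[OF LO_nonempty g] LO_torsion_free[OF LO_nonempty h] ne by auto
      next
        case False
        then show False using eq not_comm unfolding pos_commensurable_def by (metis gr0I)
      qed
    qed
    have powA: "x [^] n \<in> A" if "x \<in> A" for x and n :: nat
      using that subgroup.one_closed[OF A] subgroup.m_closed[OF A] by (induction n) auto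
    have hA: "inv h \<in> A" using ghA subgroup.m_inv_closed[OF A] by blast
    have "\<exists>Q\<in>LO (G\<lparr>carrier := A\<rparr>). U \<subseteq> Q"
    proof (rule semigroup_extends_to_subgroup_cone[OF LO_nonempty A A_comm])
      show "U \<subseteq> A"
        using ghA hA powA subgroup.m_closed[OF A] by (auto simp: U_def)
      show "\<one> \<notin> U" by (rule one)
      fix x y assume "x \<in> U" "y \<in> U"
      then obtain m n m' n' :: nat where
        *: "x = g [^] m \<otimes> inv h [^] n" "y = g [^] m' \<otimes> inv h [^] n'" "m > 0 \<or> n > 0"
        unfolding U_def by blast
      have "inv h [^] n \<otimes> g [^] m' = g [^] m' \<otimes> inv h [^] n"
        using A_comm powA ghA hA by blast
      then have "x \<otimes> y = (g [^] m \<otimes> g [^] m') \<otimes> (inv h [^] n \<otimes> inv h [^] n')"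
        unfolding *(1,2) using g h by (metis inv_closed m_assoc m_closed nat_pow_closed)
      also have "\<dots> = g [^] (m + m') \<otimes> inv h [^] (n + n')"
        using g h by (simp add: nat_pow_mult)
      finally show "x \<otimes> y \<in> U" unfolding U_def using *(3) by auto
    qed
    then obtain Q where Q: "Q \<in> LO (G\<lparr>carrier := A\<rparr>)" "U \<subseteq> Q" by blast
    have "g [^] m \<otimes> inv h [^] n \<in> U" if "m > 0 \<or> n > 0" for m n :: nat
      unfolding U_def using that by blast
    from this[of 1 0] this[of 0 1] have "g \<in> Q" "inv h \<in> Q" using Q(2) g h by auto
    then have "h \<notin> Q" using Q(1) h by (auto simp: mem_LO_subgroup_iff[OF A])
    obtain T where T: "T \<inter> A = {}" "Q \<union> T \<in> LO G"
      using centralizer_relatively_convex[OF S] Q unfolding A_def by auto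
    from same[OF this(2)] show False using T ghA \<open>g \<in> Q\<close> \<open>h \<notin> Q\<close> by blast
  qed
qed

section \<open>Automorphisms that move every element within its commensurability class\<close>

text \<open>The elements whose inner automorphisms act trivially on the left-orderings; they form a
  normal subgroup.\<close>

definition commensurating :: "'a set" where
  "commensurating = {z \<in> carrier G. \<forall>h\<in>carrier G. conjugate z h \<sim> h}"

lemma commensurating_mult:
  assumes "x \<in> commensurating" "y \<in> commensurating"
  shows "x \<otimes> y \<in> commensurating"
proof -
  have c: "x \<in> carrier G" "y \<in> carrier G" using assms by (auto simp: commensurating_def)
  have "conjugate (x \<otimes> y) h \<sim> h" if h: "h \<in> carrier G" for h
  proof (rule pos_commensurable_trans)
    show "conjugate (x \<otimes> y) h \<sim> conjugate y h" "conjugate y h \<sim> h"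
      using assms c h by (simp_all add: conjugate_mult commensurating_def)
  qed (use c h in auto)
  then show ?thesis using c by (simp add: commensurating_def)
qed

lemma commensurating_inv:
  assumes "x \<in> commensurating"
  shows "inv x \<in> commensurating"
proof -
  have c: "x \<in> carrier G" using assms by (auto simp: commensurating_def)
  have "conjugate (inv x) h \<sim> h" if h: "h \<in> carrier G" for h
  proof (rule pos_commensurable_sym)
    have "conjugate x (conjugate (inv x) h) \<sim> conjugate (inv x) h"
      using assms c h conjugate_closed inv_closed unfolding commensurating_def by blast
    then show "h \<sim> conjugate (inv x) h" using c h by simp
  qed
  then show ?thesis using c by (simp add: commensurating_def)
qed

lemma commensurating_conjugate:
  assumes "x \<in> commensurating" and g: "g \<in> carrier G"
  shows "conjugate g x \<in> commensurating"
proof -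
  have c: "x \<in> carrier G" using assms by (auto simp: commensurating_def)
  have "conjugate (conjugate g x) h \<sim> h" if h: "h \<in> carrier G" for h
  proof -
    have "conjugate x (conjugate (inv g) h) \<sim> conjugate (inv g) h"
      using assms c h by (simp add: commensurating_def)
    then have "conjugate g (conjugate x (conjugate (inv g) h)) \<sim> conjugate g (conjugate (inv g) h)"
      using c g h by (intro pos_commensurable_conjugate) auto
    moreover have "conjugate g (conjugate x (conjugate (inv g) h)) = conjugate (conjugate g x) h"
      using c g h unfolding conjugate_def[of g x] by (simp add: conjugate_mult)
    ultimately show ?thesis using g h by simp
  qed
  then show ?thesis using c g by (simp add: commensurating_def)
qed

text \<open>The commutator of \<open>z\<close> and \<open>g\<close> is the quotient of \<open>z g z\<^sup>-\<^sup>1\<close>, which lies in the class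
  of \<open>g\<close>, by \<open>g\<close> itself.\<close>

lemma commutator_commensurable:
  assumes "z \<in> commensurating" "g \<in> carrier G" "z \<otimes> g \<noteq> g \<otimes> z"
  shows "conjugate z g \<otimes> inv g \<approx> g"
  using assms
  by (intro pos_commensurable_quotient) (auto simp: commensurating_def conjugate_eq_iff)

text \<open>Suppose that \<open>z\<close> does not commute with \<open>g\<close>. Their commutator \<open>c\<close> is commensurable with \<open>g\<close>,
  so it does not commute with \<open>z\<close> either, and it is again commensurating. The commutator of \<open>z\<close> and
  \<open>c\<close> is therefore commensurable with both \<open>z\<close> and \<open>c\<close>, so these have a common nontrivial power,
  and roots of commuting elements commute.\<close>

lemma commensurating_central:
  assumes z: "z \<in> commensurating" and g: "g \<in> carrier G"
  shows "z \<otimes> g = g \<otimes> z"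
proof (rule ccontr)
  assume nc: "z \<otimes> g \<noteq> g \<otimes> z"
  have zc: "z \<in> carrier G" using z by (auto simp: commensurating_def)
  define c where "c = conjugate z g \<otimes> inv g"
  have "c = z \<otimes> conjugate g (inv z)"
    using zc g by (simp add: c_def conjugate_def m_assoc)
  then have c: "c \<in> commensurating"
    using z g by (simp add: commensurating_mult commensurating_inv commensurating_conjugate)
  then have cc: "c \<in> carrier G" by (auto simp: commensurating_def)
  have c_g: "c \<approx> g" unfolding c_def using z g nc by (rule commutator_commensurable)
  have nc': "z \<otimes> c \<noteq> c \<otimes> z"
    using nc commute_commensurable[OF commensurable_sym[OF c_g] g cc zc] by blast
  have 1: "conjugate z c \<otimes> inv c \<approx> c" using z cc nc' by (rule commutator_commensurable)
  have 2: "conjugate c z \<otimes> inv z \<approx> z"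
    using c zc nc'[symmetric] by (rule commutator_commensurable)
  have "inv (conjugate c z \<otimes> inv z) = conjugate z c \<otimes> inv c"
    using zc cc by (simp add: conjugate_def inv_mult_group m_assoc)
  then have "conjugate z c \<otimes> inv c \<approx> z" using commensurable_inv[OF 2] zc cc by simp
  then have "c \<approx> z" using commensurable_trans[OF commensurable_sym[OF 1]] zc cc by simp
  then show False using nc' commensurable_imp_commute zc cc by metis
qed

text \<open>Comparing \<open>\<phi>(x h x\<^sup>-\<^sup>1)\<close> with \<open>x h x\<^sup>-\<^sup>1\<close> shows that \<open>x\<^sup>-\<^sup>1 \<phi>(x)\<close> is commensurating, hence
  central. If it is not \<open>1\<close> then it is commensurable with \<open>x\<close>, which makes \<open>x\<close> central. So
  noncentral elements are fixed, and a central element is a quotient of two noncentral ones.\<close>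

lemma pos_commensurable_hom_trivial:
  assumes \<phi>: "group_hom G G \<phi>" and comm: "\<And>g. g \<in> carrier G \<Longrightarrow> \<phi> g \<sim> g"
    and nonabelian: "\<not> comm_group G" and x: "x \<in> carrier G"
  shows "\<phi> x = x"
proof -
  interpret \<phi>: group_hom G G \<phi> by fact
  have quot: "inv x \<otimes> \<phi> x \<in> commensurating" if x: "x \<in> carrier G" for x
  proof -
    have "conjugate (inv x \<otimes> \<phi> x) h \<sim> h" if h: "h \<in> carrier G" for h
    proof -
      have "h \<sim> \<phi> h" using comm h pos_commensurable_sym by blast
      then have "conjugate (\<phi> x) h \<sim> conjugate (\<phi> x) (\<phi> h)"
        using x h by (intro pos_commensurable_conjugate) auto
      moreover have "conjugate (\<phi> x) (\<phi> h) = \<phi> (conjugate x h)"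
        using x h by (simp add: conjugate_def)
      ultimately have "conjugate (\<phi> x) h \<sim> \<phi> (conjugate x h)" by simp
      moreover have "\<phi> (conjugate x h) \<sim> conjugate x h" using comm x h by simp
      ultimately have "conjugate (\<phi> x) h \<sim> conjugate x h"
        by (rule pos_commensurable_trans) (use x h in auto)
      then have "conjugate (inv x) (conjugate (\<phi> x) h) \<sim> conjugate (inv x) (conjugate x h)"
        using x h by (intro pos_commensurable_conjugate) auto
      then show ?thesis using x h by (simp add: conjugate_mult)
    qed
    then show ?thesis using x by (simp add: commensurating_def)
  qed
  have noncentral: "\<phi> x = x" if x: "x \<in> carrier G" and g: "g \<in> carrier G" "x \<otimes> g \<noteq> g \<otimes> x" for x g
  proof (rule ccontr)
    assume ne: "\<phi> x \<noteq> x"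
    have "\<phi> x \<otimes> inv x \<approx> x" using comm x ne by (intro pos_commensurable_quotient) auto
    moreover have "\<phi> x \<otimes> inv x = inv x \<otimes> \<phi> x"
      using commensurable_imp_commute[OF pos_commensurable_imp[OF comm[OF x]]] x
      by (metis \<phi>.hom_closed inv_closed inv_solve_left' inv_solve_right m_assoc m_closed)
    ultimately have "x \<approx> inv x \<otimes> \<phi> x" using commensurable_sym by simp
    moreover have "g \<otimes> (inv x \<otimes> \<phi> x) = (inv x \<otimes> \<phi> x) \<otimes> g"
      using commensurating_central[OF quot[OF x] g(1)] by simp
    ultimately have "g \<otimes> x = x \<otimes> g"
      using commute_commensurable[of x "inv x \<otimes> \<phi> x" g] x g(1) by simp
    then show False using g by simp
  qed
  obtain a b where ab: "a \<in> carrier G" "b \<in> carrier G" "a \<otimes> b \<noteq> b \<otimes> a"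
    using nonabelian group_comm_groupI by blast
  show ?thesis
  proof (cases "\<forall>g\<in>carrier G. x \<otimes> g = g \<otimes> x")
    case True
    have "x \<otimes> a \<otimes> b \<noteq> b \<otimes> (x \<otimes> a)"
    proof
      assume "x \<otimes> a \<otimes> b = b \<otimes> (x \<otimes> a)"
      then have "x \<otimes> (a \<otimes> b) = x \<otimes> (b \<otimes> a)"
        using True x ab by (metis m_assoc)
      then show False using x ab by simp
    qed
    then have "\<phi> (x \<otimes> a) = x \<otimes> a" using noncentral[of "x \<otimes> a" b] x ab by simp
    moreover have "\<phi> a = a" using noncentral ab by blast
    ultimately show ?thesis using x ab by simp
  next
    case False
    then show ?thesis using noncentral x by blast
  qed
qed

text \<open>Fix \<open>a \<noteq> 1\<close> with \<open>\<phi>(a)\<^sup>q = a\<^sup>p\<close> and let \<open>\<psi>(g) = \<phi>(g)\<^sup>q g\<^sup>-\<^sup>p\<close>, so that \<open>\<psi>(a) = 1\<close>. Some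
  nonzero power of \<open>\<psi>(g)\<close> is a power of \<open>g\<close>, and since \<open>\<psi>(g a) = \<psi>(g)\<close>, some nonzero power of it is
  also a power of \<open>g a\<close>. If \<open>\<psi>(g) \<noteq> 1\<close>, this yields a nonzero power of \<open>a\<close> that is a power
  \<open>g\<^sup>j\<close>. Applying \<open>\<psi>\<close> gives \<open>\<psi>(g)\<^sup>j = 1\<close>, so \<open>j = 0\<close> and \<open>a\<close> would be torsion.\<close>

lemma pos_commensurable_hom_uniform:
  assumes \<phi>: "group_hom G G \<phi>" and comm: "\<And>g. g \<in> carrier G \<Longrightarrow> \<phi> g \<sim> g"
    and abelian: "comm_group G"
  shows "\<exists>(p::nat) (q::nat). p > 0 \<and> q > 0 \<and> (\<forall>g\<in>carrier G. \<phi> g [^] q = g [^] p)"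
proof (cases "carrier G = {\<one>}")
  case True
  then show ?thesis using group_hom.hom_one[OF \<phi>] by (intro exI[of _ "1::nat"]) simp
next
  case False
  interpret \<phi>: group_hom G G \<phi> by fact
  interpret comm_group G by fact
  obtain a where a: "a \<in> carrier G" "a \<noteq> \<one>" using False by auto
  obtain p q :: nat where pq: "q > 0" "p > 0" "\<phi> a [^] q = a [^] p"
    using comm[OF a(1)] by (auto simp: pos_commensurable_def)
  define \<psi> where "\<psi> g = \<phi> g [^] q \<otimes> inv (g [^] p)" for g
  have \<psi>_closed [simp]: "\<psi> g \<in> carrier G" if "g \<in> carrier G" for g
    using that by (simp add: \<psi>_def)
  have \<psi>_mult: "\<psi> (g \<otimes> h) = \<psi> g \<otimes> \<psi> h" if "g \<in> carrier G" "h \<in> carrier G" for g h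
    using that by (simp add: \<psi>_def nat_pow_distrib inv_mult m_ac)
  interpret \<psi>: group_hom G G \<psi>
    by (intro group_hom.intro group_hom_axioms.intro) (auto simp: hom_def \<psi>_mult)
  have \<psi>_a: "\<psi> a = \<one>" using pq a by (simp add: \<psi>_def)
  have \<psi>_pow: "\<exists>(n::int) (k::int). n \<noteq> 0 \<and> \<psi> g [^] n = g [^] k" if g: "g \<in> carrier G" for g
  proof -
    obtain m n :: nat where mn: "m > 0" "n > 0" "\<phi> g [^] n = g [^] m"
      using comm[OF g] by (auto simp: pos_commensurable_def)
    have "\<psi> g [^] int n = (\<phi> g [^] q) [^] n \<otimes> inv ((g [^] p) [^] n)"
      using g by (simp add: \<psi>_def int_pow_int nat_pow_distrib nat_pow_inv)
    also have "(\<phi> g [^] q) [^] n = (\<phi> g [^] n) [^] q"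
      using g by (simp add: nat_pow_pow mult.commute)
    also have "\<dots> = g [^] (m * q)" using g mn by (simp add: nat_pow_pow)
    also have "g [^] (m * q) \<otimes> inv ((g [^] p) [^] n) = g [^] (int (m * q) - int (p * n))"
      using g by (simp only: int_pow_diff int_pow_int nat_pow_pow)
    finally show ?thesis using mn
      by (intro exI[of _ "int n"] exI[of _ "int (m * q) - int (p * n)"]) simp
  qed
  have \<psi>_one: "\<psi> g = \<one>" if g: "g \<in> carrier G" for g
  proof (rule ccontr)
    assume ne: "\<psi> g \<noteq> \<one>"
    obtain n k n' k' :: int where *: "n \<noteq> 0" "\<psi> (g \<otimes> a) [^] n = (g \<otimes> a) [^] k"
      "n' \<noteq> 0" "\<psi> g [^] n' = g [^] k'"
      using \<psi>_pow[of g] \<psi>_pow[of "g \<otimes> a"] g a by auto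
    have eq: "\<psi> g [^] n = g [^] k \<otimes> a [^] k"
      using * g a by (simp add: \<psi>_a int_pow_distrib)
    have k: "k \<noteq> 0" using eq int_pow_eq_one[of "\<psi> g" n] * ne g by auto
    \<comment> \<open>eliminating \<open>\<psi> g\<close> expresses a power of \<open>a\<close> by a power of \<open>g\<close>\<close>
    have "g [^] (k' * n) = (\<psi> g [^] n) [^] n'"
      using * g by (metis \<psi>_closed int_pow_pow mult.commute)
    also have "\<dots> = g [^] (k * n') \<otimes> a [^] (k * n')"
      using eq g a by (simp add: int_pow_distrib int_pow_pow)
    finally have a_pow: "a [^] (k * n') = g [^] (k' * n - k * n')"
      using g a by (simp add: int_pow_diff m_ac inv_solve_left)
    then have "\<psi> g [^] (k' * n - k * n') = \<psi> a [^] (k * n')"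
      using g a by (simp flip: \<psi>.hom_int_pow)
    then have "\<psi> g [^] (k' * n - k * n') = \<one>" by (simp add: \<psi>_a)
    then have "k' * n - k * n' = 0" using int_pow_eq_one[of "\<psi> g"] ne g \<psi>_closed by blast
    then have "a [^] (k * n') = \<one>" using a_pow g by simp
    moreover have "k * n' \<noteq> 0" using k *(3) by simp
    ultimately show False using int_pow_eq_one[OF a(1)] a(2) by blast
  qed
  have "\<phi> g [^] q = g [^] p" if g: "g \<in> carrier G" for g
    using \<psi>_one[OF g] g inv_equality[of "\<phi> g [^] q" "inv (g [^] p)"]
    by (simp add: \<psi>_def)
  then show ?thesis using pq by blast
qed

end

section \<open>The kernel of the action on left-orderings\<close>

lemma (in group) auto_imp_group_hom: "\<phi> \<in> auto G \<Longrightarrow> group_hom G G \<phi>"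
  by unfold_locales (simp add: auto_def)

lemma (in group) mem_kernel_LO_action_iff:
  "\<phi> \<in> kernel (AutoGroup G) (BijGroup (LO G)) (LO_action G) \<longleftrightarrow>
     \<phi> \<in> auto G \<and> (\<forall>P\<in>LO G. \<phi> ` P = P)"
proof -
  have "LO_action G \<phi> = (\<lambda>P\<in>LO G. P) \<longleftrightarrow> (\<forall>P\<in>LO G. \<phi> ` P = P)"
    by (simp add: LO_action_def restrict_def fun_eq_iff Ball_def)
  then show ?thesis by (auto simp: kernel_def AutoGroup_def BijGroup_def)
qed

lemma (in bi_ordered_group) kernel_imp_pos_commensurable:
  assumes \<phi>: "\<phi> \<in> auto G" "\<And>P. P \<in> LO G \<Longrightarrow> \<phi> ` P = P" and g: "g \<in> carrier G"
  shows "\<phi> g \<sim> g"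
proof (rule same_cones_imp_pos_commensurable)
  have bij: "bij_betw \<phi> (carrier G) (carrier G)" using \<phi> by (auto simp: auto_def Bij_def)
  then show "\<phi> g \<in> carrier G" using g by (rule bij_betw_apply)
  show "\<phi> g \<in> P \<longleftrightarrow> g \<in> P" if P: "P \<in> LO G" for P
  proof -
    have "P \<subseteq> carrier G" using P by (simp add: mem_LO_iff)
    then have "\<phi> g \<in> \<phi> ` P \<longleftrightarrow> g \<in> P"
      using bij g by (meson bij_betw_imp_inj_on inj_on_image_mem_iff)
    then show ?thesis using \<phi>(2)[OF P] by simp
  qed
qed (rule g)

lemma (in group) is_tau_iff:
  "is_tau G p q \<phi> \<longleftrightarrow> \<phi> \<in> auto G \<and> (\<forall>g\<in>carrier G. \<phi> g [^] q = g [^] p)"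
proof (cases "\<phi> \<in> auto G")
  case True
  then interpret group_hom G G \<phi> by (rule auto_imp_group_hom)
  show ?thesis unfolding is_tau_def by (simp add: hom_nat_pow)
qed (simp add: is_tau_def)

lemma (in group) tau_image_cone:
  assumes \<tau>: "is_tau G p q \<phi>" and pos: "p > 0" "q > 0" and P: "P \<in> LO G"
  shows "\<phi> ` P = P"
proof (rule LO_subset_imp_eq)
  have \<phi>: "\<phi> \<in> auto G" "\<And>g. g \<in> carrier G \<Longrightarrow> \<phi> g [^] q = g [^] p"
    using \<tau> by (auto simp: is_tau_iff)
  show "\<phi> ` P \<in> LO G" using \<phi>(1) P by (rule image_mem_LO)
  have "\<phi> g \<in> P" if g: "g \<in> P" for g
  proof -
    have gc: "g \<in> carrier G" using g P by (auto simp: mem_LO_iff)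
    have "\<phi> g \<in> carrier G" using group_hom.hom_closed[OF auto_imp_group_hom[OF \<phi>(1)]] gc by blast
    moreover have "\<phi> g [^] q \<in> P" using \<phi>(2)[OF gc] LO_nat_pow_mem[OF P g pos(1)] by simp
    ultimately show ?thesis using LO_nat_pow_mem_iff[OF P _ pos(2)] by blast
  qed
  then show "\<phi> ` P \<subseteq> P" by blast
qed (rule P)

theorem theorem1p2:
  fixes G :: "('a, 'b) monoid_scheme"
  assumes "group G" and "bi_orderable G"
  shows "(\<not> comm_group G \<longrightarrow>
            faithful_action (AutoGroup G) (LO G) (LO_action G)) \<and>
         (comm_group G \<longrightarrow>
            kernel (AutoGroup G) (BijGroup (LO G)) (LO_action G) =
              {\<phi>. \<exists>p q :: nat. p > 0 \<and> q > 0 \<and> is_tau G p q \<phi>})"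
proof (intro conjI impI)
  interpret group G by fact
  obtain r where "bi_ordering G r" using assms(2) by (auto simp: bi_orderable_def)
  then interpret bi_ordered_group G r by unfold_locales
  interpret act: group_action "AutoGroup G" "LO G" "LO_action G"
    by (rule group_action_LO_action)
  interpret act: group_hom "AutoGroup G" "BijGroup (LO G)" "LO_action G"
    by (rule act.group_hom)
  let ?K = "kernel (AutoGroup G) (BijGroup (LO G)) (LO_action G)"
  have in_K: "group_hom G G \<phi>" "\<And>g. g \<in> carrier G \<Longrightarrow> pos_commensurable (\<phi> g) g" if "\<phi> \<in> ?K" for \<phi>
    using that auto_imp_group_hom kernel_imp_pos_commensurable
    by (auto simp: mem_kernel_LO_action_iff)
  {
    assume nonabelian: "\<not> comm_group G"
    have "\<phi> = \<one>\<^bsub>AutoGroup G\<^esub>" if \<phi>: "\<phi> \<in> ?K" for \<phi>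
    proof (rule extensionalityI)
      show "\<phi> \<in> extensional (carrier G)"
        using \<phi> by (auto simp: mem_kernel_LO_action_iff auto_def Bij_def)
      show "\<one>\<^bsub>AutoGroup G\<^esub> \<in> extensional (carrier G)"
        by (simp add: AutoGroup_def BijGroup_def)
      show "\<phi> x = \<one>\<^bsub>AutoGroup G\<^esub> x" if "x \<in> carrier G" for x
        using pos_commensurable_hom_trivial[OF in_K[OF \<phi>] nonabelian that] that
        by (simp add: AutoGroup_def BijGroup_def)
    qed
    then have "?K = {\<one>\<^bsub>AutoGroup G\<^esub>}"
      using act.hom_one act.one_closed unfolding kernel_def by blast
    then have "inj_on (LO_action G) (carrier (AutoGroup G))"
      by (rule act.trivial_ker_imp_inj)
    then show "faithful_action (AutoGroup G) (LO G) (LO_action G)"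
      by unfold_locales
  }
  assume abelian: "comm_group G"
  show "?K = {\<phi>. \<exists>p q :: nat. p > 0 \<and> q > 0 \<and> is_tau G p q \<phi>}"
  proof (intro equalityI subsetI)
    fix \<phi> assume \<phi>: "\<phi> \<in> ?K"
    then have "\<phi> \<in> auto G" by (simp add: mem_kernel_LO_action_iff)
    then show "\<phi> \<in> {\<phi>. \<exists>p q :: nat. p > 0 \<and> q > 0 \<and> is_tau G p q \<phi>}"
      using pos_commensurable_hom_uniform[OF in_K[OF \<phi>] abelian] by (simp add: is_tau_iff)
  next
    fix \<phi> assume "\<phi> \<in> {\<phi>. \<exists>p q :: nat. p > 0 \<and> q > 0 \<and> is_tau G p q \<phi>}"
    then obtain p q :: nat where \<tau>: "p > 0" "q > 0" "is_tau G p q \<phi>" by blast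
    then have "\<phi> \<in> auto G" by (simp add: is_tau_def)
    then show "\<phi> \<in> ?K"
      using tau_image_cone[OF \<tau>(3,1,2)] by (simp add: mem_kernel_LO_action_iff)
  qed
qed

end
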